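(* Let $f:\mathbb{N}_{>0}\rightarrow\mathbb{R}$ be defined by $f(p)=\frac{1}{2}\left(\sqrt{p^2+2p-3}-p+3\right)$. Then $$\mu(T)\geq \rho(T)-f(n)$$ for every rooted tree $T$ of order $n$, with equality if and only if $T=\mathcal{S}_n$ (as rooted trees, up to isomorphism).
   Context: $\mathbb{N}_{>0}$ is the set of positive integers. A rooted tree $T$ is a finite tree with a distinguished vertex $r$, its root; its order $n$ is its number of vertices. The bottleneck matrix of $T$ is the matrix $M=[m_{ij}]$ indexed by $V(T)$, where $m_{ij}$ is the number of vertices lying both on the path joining $i$ to $r$ and on the path joining $j$ to $r$ (paths include their endpoints). The Perron value $\rho(T)$ is the spectral radius (largest eigenvalue) of $M$. The moment of $T$ is $\mu(T)=\sum_{v\in V(T)}\operatorname{dist}(v,r)\deg(v)$, where $\operatorname{dist}(v,r)$ is the number of edges in the path joining $v$ to $r$ and $\deg(v)$ is the degree of $v$ in $T$. $\mathcal{S}_n$ denotes the rooted star on $n$ vertices with the central vertex as root ($\mathcal{S}_1$ is the one-vertex rooted tree). *)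

theory Defs
  imports
    "Graph_Theory.Digraph_Isomorphism"
    "Jordan_Normal_Form.Spectral_Radius"
begin

text \<open>
  A simple graph is a \<^locale>\<open>pair_graph\<close>: a finite loop-free digraph whose arc relation is
  symmetric, each edge being represented by its two opposite arcs.  The library predicate
  \<^const>\<open>tree\<close> is unsuitable for this representation, because \<^const>\<open>pre_digraph.cycle\<close>
  counts going back and forth along one edge as a cycle of length 2.  The cycles of the underlying
  simple graph are those of length at least 3.
\<close>

locale rooted_tree = pair_graph T for T :: "'a pair_pre_digraph" +
  fixes r :: 'a
  assumes tree_connected: "Digraph_Component.connected (with_proj T)"
    and tree_acyclic: "\<nexists>p. pre_digraph.cycle (with_proj T) p \<and> 3 \<le> length p"
    and root_in_verts: "r \<in> pverts T"

definition tree_order :: "'a pair_pre_digraph \<Rightarrow> nat" where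
  "tree_order T = card (pverts T)"

text \<open>
  In a tree the path joining \<open>v\<close> to \<open>r\<close> is unique; it is given here by its list of arcs.
\<close>

definition root_path :: "'a pair_pre_digraph \<Rightarrow> 'a \<Rightarrow> 'a \<Rightarrow> ('a \<times> 'a) awalk" where
  "root_path T r v = (THE p. pre_digraph.apath (with_proj T) v p r)"

definition root_path_verts :: "'a pair_pre_digraph \<Rightarrow> 'a \<Rightarrow> 'a \<Rightarrow> 'a set" where
  "root_path_verts T r v =
     set (pre_digraph.awalk_verts (with_proj T) v (root_path T r v))"

definition root_dist :: "'a pair_pre_digraph \<Rightarrow> 'a \<Rightarrow> 'a \<Rightarrow> nat" where
  "root_dist T r v = length (root_path T r v)"

text \<open>
  Matrices of type \<^typ>\<open>'b mat\<close> are indexed by \<open>{0..<n}\<close>, so \<open>V(T)\<close> is enumerated by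
  \<^term>\<open>from_nat_into (pverts T)\<close>, which is a bijection from \<open>{0..<n}\<close> onto \<open>V(T)\<close>
  (\<open>bij_betw_from_nat_into_finite\<close>).  Another enumeration would permute rows and columns
  simultaneously, which does not change the spectrum.
\<close>

definition bottleneck_matrix :: "'a pair_pre_digraph \<Rightarrow> 'a \<Rightarrow> real mat" where
  "bottleneck_matrix T r =
     mat (tree_order T) (tree_order T)
       (\<lambda>(i, j). real (card (root_path_verts T r (from_nat_into (pverts T) i)
                             \<inter> root_path_verts T r (from_nat_into (pverts T) j))))"

definition perron_value :: "'a pair_pre_digraph \<Rightarrow> 'a \<Rightarrow> real" where
  "perron_value T r = spectral_radius (map_mat complex_of_real (bottleneck_matrix T r))"

text \<open>
  As the arc relation is symmetric, the out-degree of a vertex is its degree in the simple graph.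
\<close>

definition moment :: "'a pair_pre_digraph \<Rightarrow> 'a \<Rightarrow> nat" where
  "moment T r = (\<Sum>v\<in>pverts T. root_dist T r v * out_degree (with_proj T) v)"

definition rooted_iso ::
    "'a pair_pre_digraph \<Rightarrow> 'a \<Rightarrow> 'b pair_pre_digraph \<Rightarrow> 'b \<Rightarrow> bool" where
  "rooted_iso T r T' r' \<longleftrightarrow>
     (\<exists>h. pre_digraph.digraph_isomorphism (with_proj T) h
          \<and> with_proj T' = app_iso h (with_proj T)
          \<and> iso_verts h r = r')"

definition star_graph :: "nat \<Rightarrow> nat pair_pre_digraph" where
  "star_graph n =
     \<lparr>pverts = {0..<n}, parcs = {0} \<times> {1..<n} \<union> {1..<n} \<times> {0}\<rparr>"

end

theory Submission
  imports Defs
begin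

text \<open>
  Write \<open>d v\<close> for the distance of \<open>v\<close> from the root, \<open>P v\<close> for the set of vertices on the path
  from \<open>v\<close> to the root, and \<open>D\<close> for the sum of all \<open>d v\<close>.  The entry of the bottleneck matrix at
  \<open>(u, v)\<close> is \<open>|P u \<inter> P v|\<close>.  Both sides of the claim are compared through \<open>D\<close>.

  Every non-root vertex contributes one edge, whose ends are at distances \<open>d v\<close> and \<open>d v - 1\<close>, so
  the moment is \<open>2 * D - (n - 1)\<close> (\<open>moment_plus\<close>).  Since \<open>D \<ge> n - 1\<close>, with equality exactly when
  every non-root vertex is at distance 1, the moment exceeds that of the star by twice the excess
  \<open>D - (n - 1)\<close>.

  Let \<open>\<kappa> = n - 1 + f n\<close>.  It satisfies \<open>\<kappa>\<^sup>2 = (n + 1) * \<kappa> - 1\<close> and is the Perron value of the star,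
  with eigenvector 1 at the root and \<open>\<kappa> / (\<kappa> - 1)\<close> at the leaves.  This vector serves as a
  Collatz--Wielandt test vector for every tree: if a positive matrix \<open>M\<close> and a positive vector \<open>x\<close>
  satisfy \<open>M x \<le> c x\<close>, then all eigenvalues of \<open>M\<close> have modulus at most \<open>c\<close>, and less than \<open>c\<close>
  if some row is strict (\<open>positive_matrix_eigenvalue_bound\<close>).  Here \<open>c\<close> is the moment plus \<open>f n\<close>,
  that is, \<open>\<kappa> + 2 * (D - (n - 1))\<close>.

  The row of the root always gives exactly \<open>\<kappa>\<close>.  For another vertex \<open>u\<close>, the crude estimate
  \<open>|P u \<inter> P v| \<le> d v\<close>, corrected by 1 when \<open>v\<close> lies on the path from \<open>u\<close>, sums to at most
  \<open>D + d u\<close> (\<open>row_sum_le\<close>), and \<open>d u\<close> is at most \<open>1 + (D - (n - 1))\<close>; the factor 2 in front of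
  the excess is what absorbs both terms.  If the tree is not a star, then the excess is positive and
  the root row is strict, so the inequality is strict.  For a star the test vector is an
  eigenvector for \<open>\<kappa> = c\<close>, and equality holds.
\<close>

section \<open>Eigenvalues of positive matrices\<close>

text \<open>
  The enumeration \<open>b\<close> of the vertices occurs only here; afterwards eigenvectors are functions on
  the vertex set.
\<close>

lemma eigenvalue_reindexed_matrix:
  fixes K :: "'a \<Rightarrow> 'a \<Rightarrow> real"
  assumes b: "bij_betw b {0..<n} V"
  shows "eigenvalue (map_mat complex_of_real (mat n n (\<lambda>(i, j). K (b i) (b j)))) \<mu> \<longleftrightarrow>
    (\<exists>w. (\<exists>u\<in>V. w u \<noteq> 0) \<and> (\<forall>u\<in>V. (\<Sum>v\<in>V. of_real (K u v) * w v) = \<mu> * w u))"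
    (is "eigenvalue ?A \<mu> \<longleftrightarrow> ?R")
proof
  have sum_b: "(\<Sum>j = 0..<n. g (b j)) = sum g V" for g :: "'a \<Rightarrow> complex"
    using sum.reindex_bij_betw[OF b] .
  have V: "V = b ` {0..<n}" using b by (simp add: bij_betw_def)
  {
    assume "eigenvalue ?A \<mu>"
    then obtain x where x: "x \<in> carrier_vec n" "x \<noteq> 0\<^sub>v n" "?A *\<^sub>v x = \<mu> \<cdot>\<^sub>v x"
      by (auto simp: eigenvalue_def eigenvector_def)
    define w where "w u = x $ the_inv_into {0..<n} b u" for u
    have w: "w (b i) = x $ i" if "i < n" for i
      using that b by (simp add: w_def the_inv_into_f_f bij_betw_def)
    have "\<exists>i<n. x $ i \<noteq> 0"
      using x(1,2) by (metis eq_vecI carrier_vecD index_zero_vec)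
    then have nz: "\<exists>u\<in>V. w u \<noteq> 0" using w V by force
    have "(\<Sum>v\<in>V. of_real (K (b i) v) * w v) = \<mu> * w (b i)" if i: "i < n" for i
    proof -
      have "(\<Sum>v\<in>V. of_real (K (b i) v) * w v) = (\<Sum>j = 0..<n. of_real (K (b i) (b j)) * x $ j)"
        unfolding sum_b[symmetric] using w by (intro sum.cong) auto
      also have "\<dots> = (?A *\<^sub>v x) $ i"
        using x(1) i by (simp add: scalar_prod_def)
      finally show ?thesis using x i w by simp
    qed
    then show ?R using nz V by auto
  }
  assume ?R
  then obtain w where nz: "\<exists>u\<in>V. w u \<noteq> 0"
    and w: "\<And>u. u \<in> V \<Longrightarrow> (\<Sum>v\<in>V. of_real (K u v) * w v) = \<mu> * w u" by blast
  define x where "x = vec n (\<lambda>i. w (b i))"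
  have "?A *\<^sub>v x = \<mu> \<cdot>\<^sub>v x"
  proof (rule eq_vecI)
    fix i assume "i < dim_vec (\<mu> \<cdot>\<^sub>v x)"
    then have i: "i < n" by (simp add: x_def)
    then have "(?A *\<^sub>v x) $ i = (\<Sum>j = 0..<n. of_real (K (b i) (b j)) * w (b j))"
      by (simp add: x_def scalar_prod_def)
    also have "\<dots> = \<mu> * w (b i)"
      using sum_b[of "\<lambda>v. of_real (K (b i) v) * w v"] w[of "b i"] V i by simp
    finally show "(?A *\<^sub>v x) $ i = (\<mu> \<cdot>\<^sub>v x) $ i" using i by (simp add: x_def)
  qed (simp add: x_def)
  moreover have "x \<noteq> 0\<^sub>v n"
  proof
    assume "x = 0\<^sub>v n"
    then have "w (b i) = 0" if "i < n" for i using that by (metis x_def index_vec index_zero_vec(1))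
    then show False using nz V by auto
  qed
  ultimately show "eigenvalue ?A \<mu>"
    by (auto simp: eigenvalue_def eigenvector_def x_def intro!: exI[of _ x])
qed

text \<open>
  The Collatz--Wielandt bound.  Scale \<open>x\<close> by the largest ratio \<open>t\<close> of \<open>|w u|\<close> to \<open>x u\<close>; the
  eigenvalue equation in a row \<open>i\<close> where the ratio is attained gives \<open>|\<mu>| \<le> c\<close>.  If \<open>|\<mu>| = c\<close>,
  then that row is tight, and since all its entries are positive this forces \<open>|w v| = t * x v\<close>
  for every \<open>v\<close>, so every row is tight.  Hence one strict row excludes equality.
\<close>

lemma positive_matrix_eigenvalue_bound:
  fixes K :: "'a \<Rightarrow> 'a \<Rightarrow> real" and w :: "'a \<Rightarrow> complex" and x :: "'a \<Rightarrow> real"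
  assumes fin: "finite V"
    and K: "\<And>u v. u \<in> V \<Longrightarrow> v \<in> V \<Longrightarrow> K u v > 0"
    and x: "\<And>u. u \<in> V \<Longrightarrow> x u > 0"
    and row: "\<And>u. u \<in> V \<Longrightarrow> (\<Sum>v\<in>V. K u v * x v) \<le> c * x u"
    and nz: "\<exists>u\<in>V. w u \<noteq> 0"
    and w: "\<And>u. u \<in> V \<Longrightarrow> (\<Sum>v\<in>V. of_real (K u v) * w v) = \<mu> * w u"
  shows "norm \<mu> \<le> c"
    and "\<exists>u\<in>V. (\<Sum>v\<in>V. K u v * x v) < c * x u \<Longrightarrow> norm \<mu> < c"
proof -
  define t where "t = Max ((\<lambda>u. norm (w u) / x u) ` V)"
  have ne: "V \<noteq> {}" using nz by auto
  then have "t \<in> (\<lambda>u. norm (w u) / x u) ` V" unfolding t_def using fin by (intro Max_in) auto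
  then obtain i where i: "i \<in> V" "norm (w i) / x i = t" by auto
  then have wi: "norm (w i) = t * x i" using x[OF i(1)] by (simp add: field_simps)
  have le: "norm (w v) \<le> t * x v" if "v \<in> V" for v
  proof -
    have "norm (w v) / x v \<le> t" unfolding t_def using fin that by (intro Max_ge) auto
    then show ?thesis using x[OF that] by (simp add: field_simps)
  qed
  obtain u where "u \<in> V" "w u \<noteq> 0" using nz by blast
  then have "0 < t * x u" using le[of u] by (meson less_le_trans zero_less_norm_iff)
  then have t: "t > 0" using x[OF \<open>u \<in> V\<close>] by (simp add: zero_less_mult_iff)
  have mod_row: "norm \<mu> * norm (w u) \<le> (\<Sum>v\<in>V. K u v * norm (w v))" if "u \<in> V" for u
  proof -
    have "norm \<mu> * norm (w u) = norm (\<Sum>v\<in>V. of_real (K u v) * w v)"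
      using w[OF that] by (simp add: norm_mult)
    also have "\<dots> \<le> (\<Sum>v\<in>V. norm (of_real (K u v) * w v))" by (rule norm_sum)
    also have "\<dots> = (\<Sum>v\<in>V. K u v * norm (w v))"
      using K[OF that] by (intro sum.cong) (auto simp: norm_mult less_imp_le)
    finally show ?thesis .
  qed
  have mono: "K u v * norm (w v) \<le> K u v * (t * x v)" if "u \<in> V" "v \<in> V" for u v
    using le[OF that(2)] K[OF that] by (intro mult_left_mono) auto
  have scaled: "(\<Sum>v\<in>V. K u v * (t * x v)) = t * (\<Sum>v\<in>V. K u v * x v)" for u
    by (simp add: sum_distrib_left algebra_simps)
  have bound: "(\<Sum>v\<in>V. K u v * norm (w v)) \<le> t * (c * x u)" if "u \<in> V" for u
  proof -
    have "(\<Sum>v\<in>V. K u v * norm (w v)) \<le> (\<Sum>v\<in>V. K u v * (t * x v))"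
      using mono[OF that] by (intro sum_mono) auto
    also have "\<dots> \<le> t * (c * x u)"
      unfolding scaled using row[OF that] t by (intro mult_left_mono) auto
    finally show ?thesis .
  qed
  have pos: "t * x i > 0" using t x[OF i(1)] by simp
  have "norm \<mu> * (t * x i) \<le> c * (t * x i)"
    using mod_row[OF i(1)] bound[OF i(1)] by (simp add: wi algebra_simps)
  then show le_c: "norm \<mu> \<le> c" using pos by (rule mult_right_le_imp_le)
  assume "\<exists>u\<in>V. (\<Sum>v\<in>V. K u v * x v) < c * x u"
  then obtain j where j: "j \<in> V" "(\<Sum>v\<in>V. K j v * x v) < c * x j" by blast
  show "norm \<mu> < c"
  proof (rule ccontr)
    assume "\<not> norm \<mu> < c"
    with le_c have c: "norm \<mu> = c" by simp
    have tight: "norm (w v) = t * x v" if v: "v \<in> V" for v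
    proof (rule ccontr)
      assume "norm (w v) \<noteq> t * x v"
      with le[OF v] have "norm (w v) < t * x v" by simp
      then have "K i v * norm (w v) < K i v * (t * x v)" using K[OF i(1) v] by simp
      then have "(\<Sum>v\<in>V. K i v * norm (w v)) < (\<Sum>v\<in>V. K i v * (t * x v))"
        using mono[OF i(1)] v fin by (intro sum_strict_mono_ex1) auto
      also have "\<dots> \<le> t * (c * x i)"
        unfolding scaled using row[OF i(1)] t by (intro mult_left_mono) auto
      finally show False using mod_row[OF i(1)] by (simp add: wi c algebra_simps)
    qed
    have "c * (t * x j) \<le> (\<Sum>v\<in>V. K j v * (t * x v))"
      using mod_row[OF j(1)] tight j(1) c by simp
    also have "\<dots> < t * (c * x j)"
      unfolding scaled using j(2) t by (intro mult_strict_left_mono) auto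
    finally show False by (simp add: algebra_simps)
  qed
qed

section \<open>Root paths and parents\<close>

context rooted_tree
begin

abbreviation "V \<equiv> pverts T"
abbreviation "P \<equiv> root_path_verts T r"
abbreviation "d \<equiv> root_dist T r"

text \<open>
  If two paths with the same ends leave \<open>u\<close> by different arcs to \<open>a\<close> and \<open>b\<close>, then following one
  remainder and returning along the other is a walk from \<open>a\<close> to \<open>b\<close> that avoids \<open>u\<close>.  A path
  extracted from it closes up through \<open>u\<close> to a cycle of length at least 3.
\<close>

lemma apath_unique:
  assumes "apath u p w" and "apath u q w"
  shows "p = q"
  using assms
proof (induction p arbitrary: u q)
  case Nil
  then show ?case by (metis apath_Nil_iff apath_nonempty_ends)
next
  case (Cons e es)
  then have "q \<noteq> []" by (metis apath_Nil_iff apath_nonempty_ends list.distinct(1))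
  then obtain e' es' where q: "q = e' # es'" by (cases q) auto
  obtain a where e: "e = (u, a)" and ua: "(u, a) \<in> parcs T" and pa: "apath a es w"
    and ua': "u \<notin> set (awalk_verts a es)"
    using Cons.prems(1) by (cases e) (auto simp: apath_Cons_iff)
  obtain b where e': "e' = (u, b)" and ub: "(u, b) \<in> parcs T" and pb: "apath b es' w"
    and ub': "u \<notin> set (awalk_verts b es')"
    using Cons.prems(2) unfolding q by (cases e') (auto simp: apath_Cons_iff)
  show ?case
  proof (cases "a = b")
    case True
    then show ?thesis using Cons.IH pa pb q e e' by blast
  next
    case False
    define s where "s = awalk_to_apath (es @ rev_path es')"
    have wa: "awalk a es w" and wb: "awalk b es' w" using pa pb by (auto simp: apath_def)
    have wb': "awalk w (rev_path es') b" using wb by simp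
    have w: "awalk a (es @ rev_path es') b" using wa wb' by (rule awalk_appendI)
    have sub: "set s \<subseteq> set (es @ rev_path es')" unfolding s_def by (rule awalk_to_apath_subset[OF w])
    have s: "apath a s b" unfolding s_def by (rule apath_awalk_to_apath[OF w])
    then have ws: "awalk a s b" by (simp add: apath_def)
    \<comment> \<open>This is what makes the cycle longer than a single edge traversed back and forth.\<close>
    have s_ne: "s \<noteq> []" using s False by (auto simp: apath_Nil_iff)
    have "set (awalk_verts a (es @ rev_path es')) = set (awalk_verts a es) \<union> set (awalk_verts w (rev_path es'))"
      by (rule set_awalk_verts_append[OF wa wb'])
    then have u_w: "u \<notin> set (awalk_verts a (es @ rev_path es'))"
      using ua' ub' awalk_verts_rev_path[OF wb] by simp
    have u_s: "u \<notin> set (awalk_verts a s)"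
      using u_w sub unfolding set_awalk_verts[OF w] set_awalk_verts[OF ws] by auto
    have bu: "(b, u) \<in> parcs T" using ub arcs_symmetric by blast
    then have "awalk b [(b, u)] u" by (auto simp: awalk_simps dest: in_arcsD2)
    with ws have w1: "awalk a (s @ [(b, u)]) u" by (rule awalk_appendI)
    have v1: "awalk_verts a (s @ [(b, u)]) = awalk_verts a s @ [u]"
      using awalk_verts_append[OF w1] ws by simp
    have "cycle (e # s @ [(b, u)])"
      unfolding cycle_def using w1 v1 ua e s u_s
      by (intro exI[of _ u]) (auto simp: awalk_Cons_iff apath_def)
    moreover have "3 \<le> length (e # s @ [(b, u)])" using s_ne by (cases s) auto
    ultimately show ?thesis using tree_acyclic by blast
  qed
qed

lemma root_path_eqI: "apath v p r \<Longrightarrow> root_path T r v = p"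
  unfolding root_path_def using apath_unique by blast

lemma apath_root_path:
  assumes "v \<in> V"
  shows "apath v (root_path T r v) r"
proof -
  have "strongly_connected (with_proj T)"
    using symmetric_connected_imp_strongly_connected[OF sym_arcs tree_connected] .
  then have "v \<rightarrow>\<^sup>*\<^bsub>T\<^esub> r" using assms root_in_verts by (auto simp: strongly_connected_def)
  then obtain p where "apath v p r" using reachable_apath by blast
  then show ?thesis using root_path_eqI by simp
qed

lemma root_path_verts_simps:
  assumes "v \<in> V"
  shows "card (P v) = d v + 1" "v \<in> P v" "r \<in> P v" "P v \<subseteq> V"
proof -
  have p: "apath v (root_path T r v) r" by (rule apath_root_path[OF assms])
  then have w: "awalk v (root_path T r v) r" by (simp add: apath_def)
  have P: "P v = set (awalk_verts v (root_path T r v))"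
    by (simp add: root_path_verts_def awalk_verts_with_proj_eq)
  show "card (P v) = d v + 1"
    using p unfolding P by (simp add: apath_def distinct_card length_awalk_verts root_dist_def)
  show "v \<in> P v" "r \<in> P v" "P v \<subseteq> V"
    using w unfolding P
    by (auto simp: hd_in_awalk_verts elim!: awalkE')
      (metis last_in_set awalk_verts_non_Nil)
qed

lemma root_dist_root: "d r = 0"
  using root_path_eqI[of r "[]"] root_in_verts by (simp add: root_dist_def apath_Nil_iff)

lemma root_dist_pos:
  assumes "v \<in> V" "v \<noteq> r"
  shows "d v \<ge> 1"
  using apath_root_path[OF assms(1)] assms(2)
  by (cases "root_path T r v") (auto simp: root_dist_def apath_Nil_iff)

text \<open>At the root, whose path has no first arc, the value is unspecified.\<close>

definition parent :: "'a \<Rightarrow> 'a" where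
  "parent v = snd (hd (root_path T r v))"

lemma parent:
  assumes "v \<in> V" "v \<noteq> r"
  shows "(v, parent v) \<in> parcs T" and "d v = d (parent v) + 1"
proof -
  have p: "apath v (root_path T r v) r" by (rule apath_root_path[OF assms(1)])
  then obtain es where es: "root_path T r v = (v, parent v) # es"
    using assms(2) by (cases "root_path T r v") (auto simp: parent_def apath_simps)
  then have "(v, parent v) \<in> parcs T" "apath (parent v) es r"
    using p by (auto simp: apath_Cons_iff)
  then show "(v, parent v) \<in> parcs T" "d v = d (parent v) + 1"
    using root_path_eqI[of "parent v" es] es by (auto simp: root_dist_def)
qed

text \<open>
  If \<open>u\<close> is off the root path of \<open>v\<close>, prefixing the arc \<open>(u, v)\<close> to that path gives the root path
  of \<open>u\<close>.  Otherwise the reverse arc, followed by the part of the path after \<open>u\<close>, is a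
  path from \<open>v\<close> to the root, hence by uniqueness the root path of \<open>v\<close>.
\<close>

lemma arc_parent:
  assumes "(u, v) \<in> parcs T"
  shows "(u \<noteq> r \<and> v = parent u) \<or> (v \<noteq> r \<and> u = parent v)"
proof -
  let ?p = "root_path T r v"
  have uv: "u \<in> V" "v \<in> V" "u \<noteq> v" using assms by (auto dest: in_arcsD1 in_arcsD2 no_loops')
  have p: "apath v ?p r" by (rule apath_root_path[OF uv(2)])
  show ?thesis
  proof (cases "u \<in> set (awalk_verts v ?p)")
    case False
    then have "apath u ((u, v) # ?p) r" using assms p by (auto simp: apath_Cons_iff)
    then have "root_path T r u = (u, v) # ?p" and "u \<noteq> r"
      using root_path_eqI apath_nonempty_ends by blast+
    then show ?thesis by (simp add: parent_def)
  next
    case True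
    then obtain xs ys where xy: "awalk_verts v ?p = xs @ u # ys"
      by (auto simp: in_set_conv_decomp)
    have w: "awalk v ?p r" and dist: "distinct (awalk_verts v ?p)" using p by (auto simp: apath_def)
    then obtain q s where qs: "cas v q u" "cas u s r" "?p = q @ s"
       "awalk_verts v q = xs @ [u]" "awalk_verts u s = u # ys"
      using awalk_decomp_verts[of v ?p r xs u ys] xy by (auto simp: awalk_def)
    have "xs \<noteq> []" using qs(4) uv(3) w xy by (metis append_Nil awhd_of_awalk list.sel(1))
    then have "hd (awalk_verts v ?p) \<in> set xs" using xy by (metis hd_append2 hd_in_set)
    then have v: "v \<in> set xs" using w by simp
    have dist': "distinct (xs @ u # ys)" using dist unfolding xy .
    have "set s \<subseteq> parcs T" using w qs(3) by (auto simp: awalk_def)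
    then have "awalk u s r" using qs(2) uv(1) by (simp add: awalk_def)
    then have "apath u s r" using dist' qs(5) by (simp add: apath_def)
    moreover have "v \<notin> set (awalk_verts u s)" using v dist' qs(5) by auto
    ultimately have "apath v ((v, u) # s) r"
      using arcs_symmetric[OF assms] by (auto simp: apath_Cons_iff)
    then have "root_path T r v = (v, u) # s" and "v \<noteq> r"
      using root_path_eqI apath_nonempty_ends by blast+
    then show ?thesis by (simp add: parent_def)
  qed
qed

section \<open>The moment and the sum of distances\<close>

lemma parcs_eq_parent:
  "parcs T = (\<lambda>v. (v, parent v)) ` (V - {r}) \<union> (\<lambda>v. (parent v, v)) ` (V - {r})"
proof (intro equalityI subsetI)
  fix e assume e: "e \<in> parcs T"
  then show "e \<in> (\<lambda>v. (v, parent v)) ` (V - {r}) \<union> (\<lambda>v. (parent v, v)) ` (V - {r})"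
    using arc_parent[of "fst e" "snd e"] in_arcsD1[of "fst e" "snd e"] in_arcsD2[of "fst e" "snd e"]
    by (cases e) auto
next
  fix e assume "e \<in> (\<lambda>v. (v, parent v)) ` (V - {r}) \<union> (\<lambda>v. (parent v, v)) ` (V - {r})"
  then show "e \<in> parcs T" using parent(1) arcs_symmetric by auto
qed

text \<open>
  The moment is the sum of the distances of the tails of all arcs.  The arcs \<open>(v, parent v)\<close>
  contribute \<open>d v\<close> and their reversals \<open>d v - 1\<close>.
\<close>

lemma moment_plus: "moment T r + (card V - 1) = 2 * (\<Sum>v\<in>V. d v)"
proof -
  let ?U = "(\<lambda>v. (v, parent v)) ` (V - {r})" and ?D = "(\<lambda>v. (parent v, v)) ` (V - {r})"
  have fin: "finite V" by (rule pair_finite_verts)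
  have "moment T r = (\<Sum>v\<in>V. \<Sum>e\<in>{e \<in> parcs T. fst e = v}. d (fst e))"
    unfolding moment_def by (intro sum.cong) (auto simp: out_degree_def out_arcs_def)
  also have "\<dots> = (\<Sum>e\<in>parcs T. d (fst e))"
    using fin pair_finite_arcs by (intro sum.group) (auto dest: in_arcsD1)
  also have "\<dots> = (\<Sum>e\<in>?U. d (fst e)) + (\<Sum>e\<in>?D. d (fst e))"
    unfolding parcs_eq_parent
  proof (intro sum.union_disjoint)
    show "?U \<inter> ?D = {}"
    proof (rule ccontr)
      assume "?U \<inter> ?D \<noteq> {}"
      then obtain u v where uv: "u \<in> V - {r}" "v \<in> V - {r}"
        and eq: "parent v = u" "parent u = v" by blast
      have "d u = d v + 1" "d v = d u + 1" using parent(2)[of u] parent(2)[of v] uv unfolding eq by auto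
      then show False by simp
    qed
  qed (use fin in auto)
  also have "\<dots> = (\<Sum>v\<in>V - {r}. d v) + (\<Sum>v\<in>V - {r}. d (parent v))"
    by (simp add: sum.reindex inj_on_def)
  finally have "moment T r + (card V - 1) = (\<Sum>v\<in>V - {r}. d v) + (\<Sum>v\<in>V - {r}. d (parent v) + 1)"
    using fin root_in_verts by (simp add: sum_Suc)
  also have "(\<Sum>v\<in>V - {r}. d (parent v) + 1) = (\<Sum>v\<in>V - {r}. d v)"
    using parent(2) by (intro sum.cong) auto
  also have "(\<Sum>v\<in>V - {r}. d v) = (\<Sum>v\<in>V. d v)"
    using fin root_in_verts root_dist_root by (simp add: sum.remove)
  finally show ?thesis by simp
qed

lemma card_V_pos: "card V \<ge> 1"
  using pair_finite_verts root_in_verts by (metis One_nat_def Suc_leI card_gt_0_iff empty_iff)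

lemma real_moment: "real (moment T r) = 2 * (\<Sum>v\<in>V. real (d v)) - (real (card V) - 1)"
proof -
  have "real (moment T r) + real (card V - 1) = 2 * (\<Sum>v\<in>V. real (d v))"
    using arg_cong[OF moment_plus, of real] by simp
  then show ?thesis using card_V_pos by simp
qed

text \<open>
  All three facts express the excess \<open>D - (n - 1)\<close> as the sum of the nonnegative terms \<open>d v - 1\<close>
  over the non-root vertices; the last one bounds a single term by the whole sum.
\<close>

lemma sum_root_dist_ge:
  shows "(\<Sum>v\<in>V. real (d v)) \<ge> real (card V) - 1"
    and "(\<Sum>v\<in>V. real (d v)) = real (card V) - 1 \<longleftrightarrow> (\<forall>v\<in>V - {r}. d v = 1)"
    and "u \<in> V \<Longrightarrow> (\<Sum>v\<in>V. real (d v)) \<ge> real (card V) - 2 + real (d u)"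
proof -
  have fin: "finite V" by (rule pair_finite_verts)
  have excess: "(\<Sum>v\<in>V. real (d v)) = real (card V) - 1 + (\<Sum>v\<in>V - {r}. real (d v) - 1)"
    using fin root_in_verts root_dist_root card_V_pos by (simp add: sum.remove sum_subtractf)
  have ge: "real (d v) - 1 \<ge> 0" if "v \<in> V - {r}" for v
    using that root_dist_pos[of v] by simp
  then have ge_sum: "(\<Sum>v\<in>V - {r}. real (d v) - 1) \<ge> 0" by (rule sum_nonneg)
  show "(\<Sum>v\<in>V. real (d v)) \<ge> real (card V) - 1"
    using ge_sum excess by simp
  show "(\<Sum>v\<in>V. real (d v)) = real (card V) - 1 \<longleftrightarrow> (\<forall>v\<in>V - {r}. d v = 1)"
    using sum_nonneg_eq_0_iff[of "V - {r}", OF _ ge] fin excess by auto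
  assume u: "u \<in> V"
  have "real (d u) - 1 \<le> (\<Sum>v\<in>V - {r}. real (d v) - 1)"
  proof (cases "u = r")
    case True
    then show ?thesis using ge_sum root_dist_root by simp
  next
    case False
    then show ?thesis using member_le_sum[of u "V - {r}" "\<lambda>v. real (d v) - 1"] ge u fin by auto
  qed
  then show "(\<Sum>v\<in>V. real (d v)) \<ge> real (card V) - 2 + real (d u)"
    using excess by simp
qed

section \<open>Rooted stars\<close>

text \<open>
  An isomorphism pulls the arc from a leaf of the star to its centre back to an arc from the vertex
  to \<open>r\<close>, which is then a root path of length 1.  Conversely, if all distances are 1, then \<open>r\<close> is the
  parent of every other vertex, which determines the arcs, and any bijection sending \<open>r\<close> to the
  centre is an isomorphism.
\<close>

lemma rooted_iso_star_iff:
  "rooted_iso T r (star_graph (card V)) 0 \<longleftrightarrow> (\<forall>v\<in>V - {r}. d v = 1)"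
proof
  assume "rooted_iso T r (star_graph (card V)) 0"
  then obtain h where h: "digraph_isomorphism h"
    and star: "with_proj (star_graph (card V)) = app_iso h (with_proj T)"
    and hr: "iso_verts h r = 0" by (auto simp: rooted_iso_def)
  have verts: "{0..<card V} = iso_verts h ` V"
    and arcs: "{0} \<times> {1..<card V} \<union> {1..<card V} \<times> {0} = iso_arcs h ` parcs T"
    and ends: "iso_tail h = fst" "iso_head h = snd"
    using arg_cong[OF star, of verts] arg_cong[OF star, of arcs]
      arg_cong[OF star, of tail] arg_cong[OF star, of head]
    by (simp_all add: star_graph_def)
  have inj: "inj_on (iso_verts h) V"
    and hom: "\<And>a. a \<in> parcs T \<Longrightarrow> iso_verts h (fst a) = fst (iso_arcs h a)
                  \<and> iso_verts h (snd a) = snd (iso_arcs h a)"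
    using h ends by (auto simp: digraph_isomorphism_def)
  show "\<forall>v\<in>V - {r}. d v = 1"
  proof
    fix v assume v: "v \<in> V - {r}"
    have "iso_verts h v \<noteq> 0" using v hr inj root_in_verts by (metis DiffE inj_on_eq_iff singletonI)
    moreover have "iso_verts h v \<in> {0..<card V}" using v verts by auto
    ultimately have "(iso_verts h v, 0) \<in> iso_arcs h ` parcs T" unfolding arcs[symmetric] by auto
    then obtain a where a: "(iso_verts h v, 0) = iso_arcs h a" "a \<in> parcs T" by (rule imageE)
    have "iso_verts h (fst a) = iso_verts h v" "iso_verts h (snd a) = iso_verts h r"
      unfolding hr using hom[OF a(2)] unfolding a(1)[symmetric] by simp_all
    then have "fst a = v" "snd a = r"
      using inj_onD[OF inj] v root_in_verts arc_fst_in_verts[OF a(2)] arc_snd_in_verts[OF a(2)]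
      by auto
    then have "(v, r) \<in> parcs T" using a(2) by (metis prod.collapse)
    then have "apath v [(v, r)] r" using v root_in_verts by (auto simp: apath_simps)
    then show "d v = 1" using root_path_eqI by (simp add: root_dist_def)
  qed
next
  assume one: "\<forall>v\<in>V - {r}. d v = 1"
  have par: "parent v = r" if "v \<in> V - {r}" for v
  proof -
    have "parent v \<in> V" using parent(1)[of v] that in_arcsD2 by auto
    moreover have "d (parent v) = 0" using parent(2)[of v] that one by auto
    ultimately show ?thesis using root_dist_pos[of "parent v"] by fastforce
  qed
  have arcsT: "parcs T = {r} \<times> (V - {r}) \<union> (V - {r}) \<times> {r}"
    unfolding parcs_eq_parent using par by (auto simp: image_iff)
  have fin: "finite V" by (rule pair_finite_verts)
  have "card (V - {r}) = card {1..<card V}" using fin root_in_verts by simp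
  then obtain g where g: "bij_betw g (V - {r}) {1..<card V}"
    using fin by (metis finite_Diff finite_atLeastLessThan finite_same_card_bij)
  define k where "k v = (if v = r then 0 else g v)" for v
  have kr: "k r = 0" by (simp add: k_def)
  have k_img: "k ` (V - {r}) = {1..<card V}"
    using g by (auto simp: k_def bij_betw_def image_iff) 
  have k_inj: "inj_on k V"
  proof (rule inj_onI)
    fix u v assume uv: "u \<in> V" "v \<in> V" "k u = k v"
    have nz: "k w \<noteq> 0" if "w \<in> V" "w \<noteq> r" for w
      using that k_img by (metis DiffI atLeastLessThan_iff imageI not_one_le_zero singletonD)
    show "u = v"
    proof (cases "u = r \<or> v = r")
      case True
      then show ?thesis using uv kr nz by metis
    next
      case False
      then have "g u = g v" using uv(3) by (simp add: k_def)
      then show ?thesis using g uv(1,2) False by (auto simp: bij_betw_def dest: inj_onD)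
    qed
  qed
  have "V = insert r (V - {r})" using root_in_verts by auto
  then have "k ` V = insert 0 (k ` (V - {r}))" using kr by (metis image_insert)
  then have k_V: "k ` V = {0..<card V}" unfolding k_img using card_V_pos by auto
  let ?h = "\<lparr>iso_verts = k, iso_arcs = map_prod k k, iso_head = snd, iso_tail = fst\<rparr>"
  have "map_prod k k ` parcs T = {0} \<times> {1..<card V} \<union> {1..<card V} \<times> {0}"
    unfolding arcsT image_Un map_prod_surj_on[OF refl refl] k_img by (simp add: kr)
  then have "with_proj (star_graph (card V)) = app_iso ?h (with_proj T)"
    using k_V by (intro pre_digraph.equality) (simp_all add: star_graph_def)
  moreover have "digraph_isomorphism ?h"
  proof -
    have "inj_on (map_prod k k) (V \<times> V)" using k_inj k_inj by (rule map_prod_inj_on)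
    moreover have "parcs T \<subseteq> V \<times> V" by (auto dest: in_arcsD1 in_arcsD2)
    ultimately have "inj_on (map_prod k k) (parcs T)" by (rule inj_on_subset)
    then show ?thesis using k_inj wf_digraph_axioms by (simp add: digraph_isomorphism_def)
  qed
  ultimately show "rooted_iso T r (star_graph (card V)) 0"
    unfolding rooted_iso_def using kr by (intro exI[of _ ?h]) simp
qed

section \<open>The bottleneck matrix and its row sums\<close>

abbreviation common :: "'a \<Rightarrow> 'a \<Rightarrow> real" where
  "common u v \<equiv> real (card (P u \<inter> P v))"

lemma spectrum_bottleneck_matrix:
  "eigenvalue (map_mat complex_of_real (bottleneck_matrix T r)) \<mu> \<longleftrightarrow>
    (\<exists>w. (\<exists>u\<in>V. w u \<noteq> 0) \<and> (\<forall>u\<in>V. (\<Sum>v\<in>V. of_real (common u v) * w v) = \<mu> * w u))"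
  unfolding bottleneck_matrix_def tree_order_def
  by (rule eigenvalue_reindexed_matrix)
    (use bij_betw_from_nat_into_finite[OF pair_finite_verts] in \<open>simp add: atLeast0LessThan\<close>)

lemma perron_value_mem:
  obtains \<mu> where "eigenvalue (map_mat complex_of_real (bottleneck_matrix T r)) \<mu>"
    and "perron_value T r = norm \<mu>"
proof -
  let ?A = "map_mat complex_of_real (bottleneck_matrix T r)"
  have "?A \<in> carrier_mat (card V) (card V)" by (simp add: bottleneck_matrix_def tree_order_def)
  from spectral_radius_mem_max(1)[OF this] show ?thesis
    using card_V_pos that by (auto simp: perron_value_def spectrum_def)
qed

lemma norm_le_perron_value:
  assumes "eigenvalue (map_mat complex_of_real (bottleneck_matrix T r)) \<mu>"
  shows "norm \<mu> \<le> perron_value T r"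
proof -
  let ?A = "map_mat complex_of_real (bottleneck_matrix T r)"
  have "?A \<in> carrier_mat (card V) (card V)" by (simp add: bottleneck_matrix_def tree_order_def)
  from spectral_radius_mem_max(2)[OF this] show ?thesis
    using card_V_pos assms by (auto simp: perron_value_def spectrum_def)
qed

lemma common_root:
  assumes "v \<in> V"
  shows "common r v = 1" "common v r = 1"
proof -
  have "card (P r) = 1" "r \<in> P r"
    using root_path_verts_simps[OF root_in_verts] root_dist_root by auto
  then have "P r = {r}" by (metis card_1_singletonE singletonD)
  then show "common r v = 1" "common v r = 1" using root_path_verts_simps(3)[OF assms] by auto
qed

lemma common_pos:
  assumes "u \<in> V" "v \<in> V"
  shows "common u v > 0"
proof -
  have "r \<in> P u \<inter> P v" using assms root_path_verts_simps(3) by auto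
  moreover have "finite (P u \<inter> P v)" using assms root_path_verts_simps(4) pair_finite_verts
    by (meson finite_Int rev_finite_subset)
  ultimately show ?thesis by (auto simp: card_gt_0_iff)
qed

lemma common_self: "u \<in> V \<Longrightarrow> common u u = d u + 1"
  using root_path_verts_simps(1) by simp

text \<open>
  The set \<open>P v\<close> has \<open>d v + 1\<close> elements, and \<open>v\<close> itself is missing from \<open>P u\<close> unless it lies on the
  path from \<open>u\<close>.
\<close>

lemma common_le:
  assumes "v \<in> V"
  shows "common u v \<le> real (d v) + (if v \<in> P u then 1 else 0)"
proof -
  have fin: "finite (P v)"
    using assms root_path_verts_simps(4) pair_finite_verts by (meson rev_finite_subset)
  show ?thesis
  proof (cases "v \<in> P u")
    case True
    have "card (P u \<inter> P v) \<le> card (P v)" using fin by (intro card_mono) auto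
    then show ?thesis using True root_path_verts_simps(1)[OF assms] by simp
  next
    case False
    then have "card (P u \<inter> P v) \<le> card (P v - {v})" using fin by (intro card_mono) auto
    then show ?thesis using False root_path_verts_simps(1,2)[OF assms] by simp
  qed
qed

text \<open>
  Off the diagonal, the corrections in \<open>common_le\<close> count the vertices of the path from \<open>u\<close> other
  than its ends, which number \<open>d u - 1\<close>.  Together with the diagonal entry \<open>d u + 1\<close> and
  the sum \<open>D - d u\<close> over the remaining vertices, this gives \<open>D + d u\<close>.
\<close>

lemma row_sum_le:
  assumes u: "u \<in> V" "u \<noteq> r"
  shows "(\<Sum>v\<in>V - {r}. common u v) \<le> (\<Sum>v\<in>V. real (d v)) + d u"
proof -
  have fin: "finite V" by (rule pair_finite_verts)
  have finP: "finite (P u)"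
    using u root_path_verts_simps(4) fin by (meson rev_finite_subset)
  have "(\<Sum>v\<in>V - {r} - {u}. common u v)
      \<le> (\<Sum>v\<in>V - {r} - {u}. real (d v) + (if v \<in> P u then 1 else 0))"
    by (rule sum_mono, rule common_le) simp
  also have "\<dots> = (\<Sum>v\<in>V - {r} - {u}. real (d v)) + real (card ((V - {r} - {u}) \<inter> P u))"
    using fin by (simp add: sum.distrib sum.If_cases Int_def)
  also have "(V - {r} - {u}) \<inter> P u = P u - {r, u}"
    using root_path_verts_simps(4)[OF u(1)] by auto
  also have "real (card (P u - {r, u})) = real (d u) - 1"
    using root_path_verts_simps[OF u(1)] finP u(2) root_dist_pos[OF u] by (simp add: card_Diff_subset)
  finally have "(\<Sum>v\<in>V - {r} - {u}. common u v)
      \<le> (\<Sum>v\<in>V - {r} - {u}. real (d v)) + (real (d u) - 1)" .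
  moreover have "(\<Sum>v\<in>V - {r}. common u v) = common u u + (\<Sum>v\<in>V - {r} - {u}. common u v)"
    using fin u by (intro sum.remove) auto
  moreover have "(\<Sum>v\<in>V. real (d v)) = d r + (d u + (\<Sum>v\<in>V - {r} - {u}. real (d v)))"
    using fin u root_in_verts by (simp add: sum.remove[of V r] sum.remove[of "V - {r}" u])
  ultimately show ?thesis using common_self[OF u(1)] by simp
qed

lemma row_sum_star:
  assumes one: "\<forall>v\<in>V - {r}. d v = 1" and u: "u \<in> V" "u \<noteq> r"
  shows "(\<Sum>v\<in>V - {r}. common u v) = card V"
proof -
  have fin: "finite V" by (rule pair_finite_verts)
  have P: "P v = {v, r}" if v: "v \<in> V - {r}" for v
  proof -
    have "card (P v) = card {v, r}" "{v, r} \<subseteq> P v" "finite (P v)"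
      using root_path_verts_simps[of v] v one finite_subset[OF _ fin] by auto
    then show ?thesis by (metis card_subset_eq)
  qed
  have "common u v = 1 + (if v = u then 1 else 0)" if "v \<in> V - {r}" for v
    using P[OF that] P[of u] u that by auto
  then have "(\<Sum>v\<in>V - {r}. common u v) = (\<Sum>v\<in>V - {r}. 1 + (if v = u then 1 else 0))"
    by (intro sum.cong) auto
  also have "\<dots> = card V"
    using fin u root_in_verts card_V_pos by (simp add: sum.distrib)
  finally show ?thesis .
qed

text \<open>
  For \<open>\<kappa>\<close> the Perron value of the star, this is its Perron vector, normalised to 1 at the root.  The
  normalisation matters for the one-vertex tree, where \<open>\<kappa> = 1\<close>: the quotient is then 0, but is
  taken at no vertex.
\<close>

definition star_weight :: "real \<Rightarrow> 'a \<Rightarrow> real" where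
  "star_weight \<kappa> v = (if v = r then 1 else \<kappa> / (\<kappa> - 1))"

lemma star_weight_row:
  assumes "u \<in> V"
  shows "(\<Sum>v\<in>V. common u v * star_weight \<kappa> v)
    = 1 + \<kappa> / (\<kappa> - 1) * (\<Sum>v\<in>V - {r}. common u v)"
proof -
  have "(\<Sum>v\<in>V. common u v * star_weight \<kappa> v)
      = 1 + (\<Sum>v\<in>V - {r}. common u v * star_weight \<kappa> v)"
    using pair_finite_verts root_in_verts common_root[OF assms]
    by (simp add: sum.remove star_weight_def)
  also have "(\<Sum>v\<in>V - {r}. common u v * star_weight \<kappa> v)
      = \<kappa> / (\<kappa> - 1) * (\<Sum>v\<in>V - {r}. common u v)"
    unfolding sum_distrib_left by (intro sum.cong) (auto simp: star_weight_def)
  finally show ?thesis .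
qed

end

text \<open>
  This \<open>\<kappa>\<close> is the larger root \<open>(n + 1 + sqrt ((n + 1)\<^sup>2 - 4)) / 2\<close> of the quadratic obtained by
  eliminating the leaf value from the eigenvalue equations of the star.
\<close>

lemma star_value_quadratic:
  fixes n :: nat
  defines "\<kappa> \<equiv> real n - 1 + 1 / 2 * (sqrt ((real n)\<^sup>2 + 2 * real n - 3) - real n + 3)"
  assumes "n \<ge> 1"
  shows "\<kappa> * \<kappa> = (real n + 1) * \<kappa> - 1" and "n \<ge> 2 \<Longrightarrow> \<kappa> > 1" and "n = 1 \<Longrightarrow> \<kappa> = 1"
proof -
  define s where "s = sqrt ((real n)\<^sup>2 + 2 * real n - 3)"
  have "(real n)\<^sup>2 \<ge> 1" using assms(2) by simp
  then have "(real n)\<^sup>2 + 2 * real n - 3 \<ge> 0" using assms(2) by linarith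
  then have s: "s * s = real n * real n + 2 * real n - 3" "s \<ge> 0"
    unfolding s_def by (simp_all add: power2_eq_square)
  have l: "\<kappa> = (real n + 1 + s) / 2" unfolding \<kappa>_def s_def by (simp add: field_simps)
  have "4 * (\<kappa> * \<kappa>) = (real n + 1) * (real n + 1) + 2 * (real n + 1) * s + s * s"
    unfolding l by (simp add: field_simps)
  also have "\<dots> = 4 * ((real n + 1) * \<kappa> - 1)" unfolding s(1) l by (simp add: field_simps)
  finally show "\<kappa> * \<kappa> = (real n + 1) * \<kappa> - 1" by simp
  show "\<kappa> > 1" if "n \<ge> 2" using that s(2) unfolding l by simp
  show "\<kappa> = 1" if "n = 1" using that unfolding \<kappa>_def by simp
qed

theorem theorem5p1:
  fixes f :: "nat \<Rightarrow> real"
    and T :: "'a pair_pre_digraph" and r :: 'a and n :: nat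
  assumes f: "\<And>p. p > 0 \<Longrightarrow> f p = 1 / 2 * (sqrt ((real p)\<^sup>2 + 2 * real p - 3) - real p + 3)"
    and T: "rooted_tree T r"
    and n: "tree_order T = n"
  shows "real (moment T r) \<ge> perron_value T r - f n
    \<and> (real (moment T r) = perron_value T r - f n \<longleftrightarrow> rooted_iso T r (star_graph n) 0)"
proof -
  interpret rooted_tree T r by (rule T)
  have nV: "n = card V" using n by (simp add: tree_order_def)
  have n1: "n \<ge> 1" using card_V_pos nV by simp
  define D where "D = (\<Sum>v\<in>V. real (d v))"
  define \<kappa> where "\<kappa> = real n - 1 + f n"
  define c where "c = real (moment T r) + f n"
  define x where "x = star_weight \<kappa>"
  have lam: "\<kappa> = real n - 1 + 1 / 2 * (sqrt ((real n)\<^sup>2 + 2 * real n - 3) - real n + 3)"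
    using f n1 by (simp add: \<kappa>_def)
  note quad = star_value_quadratic[OF n1, folded lam]
  have c: "c = \<kappa> + 2 * (D - (real n - 1))"
    using real_moment by (simp add: c_def \<kappa>_def D_def nV)
  have D_ge: "D \<ge> real n - 1" using sum_root_dist_ge(1) by (simp add: D_def nV)
  have two: "n \<ge> 2" if "u \<in> V" "u \<noteq> r" for u
  proof -
    have "card {u, r} \<le> card V" using that root_in_verts pair_finite_verts by (intro card_mono) auto
    then show ?thesis using that nV by simp
  qed
  have xr: "x r = 1" by (simp add: x_def star_weight_def)
  have xu: "x u = \<kappa> / (\<kappa> - 1)" if "u \<noteq> r" for u using that by (simp add: x_def star_weight_def)
  have x_pos: "x u > 0" if "u \<in> V" for u
    using quad(2) two[of u] that xr xu[of u] by (cases "u = r") auto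
  have root_row: "(\<Sum>v\<in>V. common r v * x v) = \<kappa>"
  proof -
    have "(\<Sum>v\<in>V - {r}. common r v) = real n - 1"
      using common_root(1) root_in_verts pair_finite_verts n1 nV by simp
    then have "(\<Sum>v\<in>V. common r v * x v) = 1 + \<kappa> / (\<kappa> - 1) * (real n - 1)"
      unfolding x_def star_weight_row[OF root_in_verts] by simp
    also have "\<dots> = \<kappa>"
    proof (cases "n = 1")
      case False
      then have "\<kappa> > 1" using quad(2) n1 by simp
      then show ?thesis using quad(1) by (simp add: field_simps)
    qed (use quad(3) in simp)
    finally show ?thesis .
  qed
  \<comment> \<open>The eigenvalue equation of the star at a leaf, where the row sum without the root is \<open>n\<close>.\<close>
  have weight: "\<kappa> * x u = 1 + real n * x u" if "u \<in> V" "u \<noteq> r" for u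
  proof -
    have gt: "\<kappa> > 1" by (rule quad(2)[OF two[OF that]])
    then have "(\<kappa> - 1) * (\<kappa> * x u) = \<kappa> * \<kappa>" using xu[OF that(2)] by simp
    also have "\<dots> = (\<kappa> - 1) + real n * \<kappa>" using quad(1) by (simp add: algebra_simps)
    also have "\<dots> = (\<kappa> - 1) * (1 + real n * x u)"
      using gt xu[OF that(2)] by (simp add: field_simps)
    finally show ?thesis using gt by simp
  qed
  have row: "(\<Sum>v\<in>V. common u v * x v) \<le> c * x u" if u: "u \<in> V" for u
  proof (cases "u = r")
    case True
    then show ?thesis using root_row xr c D_ge by simp
  next
    case False
    have "D + d u \<le> real n + 2 * (D - (real n - 1))"
      using sum_root_dist_ge(3)[OF u] by (simp add: D_def nV)
    then have "(\<Sum>v\<in>V - {r}. common u v) \<le> real n + 2 * (D - (real n - 1))"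
      using row_sum_le[OF u False] by (simp add: D_def)
    then have "x u * (\<Sum>v\<in>V - {r}. common u v) \<le> x u * (real n + 2 * (D - (real n - 1)))"
      using x_pos[OF u] by (intro mult_left_mono) auto
    moreover have "(\<Sum>v\<in>V. common u v * x v) = 1 + x u * (\<Sum>v\<in>V - {r}. common u v)"
      unfolding x_def star_weight_row[OF u] using False by (simp add: star_weight_def)
    moreover have "c * x u = 1 + x u * (real n + 2 * (D - (real n - 1)))"
      unfolding c using weight[OF u False] by (simp add: algebra_simps)
    ultimately show ?thesis by linarith
  qed
  obtain \<mu> where eig: "eigenvalue (map_mat complex_of_real (bottleneck_matrix T r)) \<mu>"
    and \<mu>: "perron_value T r = norm \<mu>" by (rule perron_value_mem)
  from eig obtain w where nz: "\<exists>u\<in>V. w u \<noteq> 0"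
    and w: "\<And>u. u \<in> V \<Longrightarrow> (\<Sum>v\<in>V. of_real (common u v) * w v) = \<mu> * w u"
    unfolding spectrum_bottleneck_matrix by blast
  note bound = positive_matrix_eigenvalue_bound[OF pair_finite_verts common_pos x_pos row nz w]
  have le: "perron_value T r \<le> c" using bound(1) \<mu> by simp
  have strict: "perron_value T r < c" if "D \<noteq> real n - 1"
  proof -
    have "(\<Sum>v\<in>V. common r v * x v) < c * x r" using root_row xr c D_ge that by simp
    then show ?thesis using bound(2) root_in_verts \<mu> by auto
  qed
  have star: "perron_value T r = c" if D: "D = real n - 1"
  proof -
    have one: "\<forall>v\<in>V - {r}. d v = 1" using D sum_root_dist_ge(2) by (simp add: D_def nV)
    have eig: "(\<Sum>v\<in>V. common u v * x v) = \<kappa> * x u" if u: "u \<in> V" for u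
    proof (cases "u = r")
      case True
      then show ?thesis using root_row xr by simp
    next
      case False
      then have "(\<Sum>v\<in>V. common u v * x v) = 1 + x u * real n"
        unfolding x_def star_weight_row[OF u] row_sum_star[OF one u False] nV
        by (simp add: star_weight_def)
      then show ?thesis using weight[OF u False] by (simp add: algebra_simps)
    qed
    have "(\<Sum>v\<in>V. of_real (common u v) * complex_of_real (x v)) = of_real \<kappa> * of_real (x u)"
      if "u \<in> V" for u
      using arg_cong[OF eig[OF that], of complex_of_real] by simp
    moreover have "\<exists>u\<in>V. complex_of_real (x u) \<noteq> 0"
      by (intro bexI[of _ r]) (use root_in_verts xr in simp_all)
    ultimately have "eigenvalue (map_mat complex_of_real (bottleneck_matrix T r)) (of_real \<kappa>)"
      unfolding spectrum_bottleneck_matrix by (intro exI[of _ "\<lambda>v. of_real (x v)"]) auto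
    from norm_le_perron_value[OF this] have "\<kappa> \<le> perron_value T r" by simp
    then show ?thesis using le c D by simp
  qed
  have "rooted_iso T r (star_graph n) 0 \<longleftrightarrow> D = real n - 1"
    using rooted_iso_star_iff sum_root_dist_ge(2) by (simp add: D_def nV)
  then show ?thesis using le strict star unfolding c_def by (auto simp: algebra_simps)
qed

end
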